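(* For all $\lambda\in\Omega_0^-$, the functions $u_0(\lambda,x)$, $u_0'(\lambda,x)$ and $u_0''(\lambda,x)$ of $x$ (primes denote $d/dx$) belong to the space $L^2(\mathbb{R}_-)$.
   Context: Setting: $m:\mathbb{R}\to\mathbb{R}$ is a measurable function having limits $m_\pm=\lim_{x\to\pm\infty}m(x)$ with $0<m_\pm<\infty$, and there is $a>0$ with $\int_{\mathbb{R}_\pm}|m(x)-m_\pm|^2e^{2a|x|}dx<\infty$. Put $n_-=m_-^{1/3}>0$, $z_-=\lambda n_-$. Let $\zeta_0=1$, $\zeta_1=\frac12(-1+i\sqrt3)$, $\zeta_2=\frac12(-1-i\sqrt3)$ and $s_2(z)=\frac13\left(e^{\zeta_0z}+\zeta_1^{-2}e^{\zeta_1z}+\zeta_2^{-2}e^{\zeta_2z}\right)$. The sector is $\Omega_0^-=\{\lambda:-\lambda\in\Omega_0\}$ with $\Omega_0=\{\alpha+i\beta:\ \alpha,\beta\in\mathbb{R},\ |\alpha|<\sqrt3\,\beta\}$. For $\lambda\in\Omega_0^-$ the Jost solution at $-\infty$ of $iy'''(x)=m(x)\lambda^3y(x)$ is $u_0(\lambda,x)=e^{iz_-x}\varphi_0(\lambda,x)$, where $\varphi_0$ is the solution, given by the convergent Neumann series, of $$\varphi_0(\lambda,x)=1+iz_-\int_{-\infty}^xe^{iz_-(t-x)}s_2(iz_-(x-t))\left(\frac{m(t)}{m_-}-1\right)\varphi_0(\lambda,t)dt .$$ *)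

theory Defs
  imports "HOL-Analysis.Analysis"
begin

definition Omega0 :: "complex set" where
  "Omega0 = {Complex \<alpha> \<beta> |\<alpha> \<beta>. \<bar>\<alpha>\<bar> < sqrt 3 * \<beta>}"

definition Omega0_minus :: "complex set" where
  "Omega0_minus = {lam. - lam \<in> Omega0}"

definition zeta :: "nat \<Rightarrow> complex" where
  "zeta k = (if k = 0 then 1
             else if k = 1 then (- 1 + \<i> * complex_of_real (sqrt 3)) / 2
             else (- 1 - \<i> * complex_of_real (sqrt 3)) / 2)"

definition s2 :: "complex \<Rightarrow> complex" where
  "s2 z = (exp (zeta 0 * z)
           + zeta 1 powi (- 2) * exp (zeta 1 * z)
           + zeta 2 powi (- 2) * exp (zeta 2 * z)) / 3"

text \<open>In what follows \<open>mm\<close> is the limit of the coefficient \<open>m\<close> at \<open>-\<infinity>\<close>.\<close>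

definition z_minus :: "real \<Rightarrow> complex \<Rightarrow> complex" where
  "z_minus mm lam = lam * complex_of_real (root 3 mm)"

text \<open>The Volterra operator \<open>K\<close> for which the integral equation of the Jost solution
  at \<open>-\<infinity>\<close> reads \<open>\<phi> = 1 + K \<phi>\<close>.\<close>

definition jost_op ::
  "(real \<Rightarrow> real) \<Rightarrow> real \<Rightarrow> complex \<Rightarrow> (real \<Rightarrow> complex) \<Rightarrow> real \<Rightarrow> complex" where
  "jost_op m mm lam \<phi> x =
     \<i> * z_minus mm lam *
     (LINT t:{..x}|lebesgue.
        exp (\<i> * z_minus mm lam * complex_of_real (t - x)) *
        s2 (\<i> * z_minus mm lam * complex_of_real (x - t)) *
        complex_of_real (m t / mm - 1) * \<phi> t)"

text \<open>The solution of \<open>\<phi> = 1 + K \<phi>\<close> given by its Neumann series, the pointwise sum of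
  the iterates of \<open>K\<close> on the constant function \<open>1\<close>.\<close>

definition phi0 :: "(real \<Rightarrow> real) \<Rightarrow> real \<Rightarrow> complex \<Rightarrow> real \<Rightarrow> complex" where
  "phi0 m mm lam x = (\<Sum>n. (jost_op m mm lam ^^ n) (\<lambda>_. 1) x)"

definition u0 :: "(real \<Rightarrow> real) \<Rightarrow> real \<Rightarrow> complex \<Rightarrow> real \<Rightarrow> complex" where
  "u0 m mm lam x = exp (\<i> * z_minus mm lam * complex_of_real x) * phi0 m mm lam x"

definition L2_on :: "real set \<Rightarrow> (real \<Rightarrow> complex) \<Rightarrow> bool" where
  "L2_on S f \<longleftrightarrow> set_borel_measurable lebesgue S f \<and>
                 set_integrable lebesgue S (\<lambda>x. (cmod (f x))\<^sup>2)"

end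

theory Submission
  imports Defs
begin

text \<open>
  Put \<open>w = i z\<^sub>-\<close>. On the sector, \<open>Re w > 0\<close> and \<open>Re ((\<zeta>\<^sub>j - 1) w) \<le> 0\<close>, so the kernel
  \<open>exp(- w s) s2(w s)\<close> and all its derivatives are bounded for \<open>s \<ge> 0\<close>. Since
  \<open>q = m / m\<^sub>- - 1\<close> is square integrable against \<open>exp(- 2 a t)\<close> on every half line
  \<open>(- \<infinity>, X]\<close>, the Cauchy-Schwarz inequality turns a bound by \<open>exp(n a x)\<close> into a bound by
  \<open>exp((n + 1) a x) / sqrt(n + 1)\<close> at each application of the Volterra operator. Hence the
  \<open>n\<close>-th Neumann iterate is at most \<open>D\<^sup>n exp(n a x) / sqrt(n!)\<close>, the series converges to a
  bounded solution \<open>\<phi>\<close>, and \<open>\<phi> = 1 + K \<phi>\<close>. The kernel and its first derivative vanish at \<open>0\<close>,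
  so \<open>K \<phi>\<close> can be differentiated twice under the integral, and \<open>\<phi>\<close>, \<open>\<phi>'\<close>, \<open>\<phi>''\<close> are bounded
  on the negative half line. The factor \<open>exp(w x)\<close> of \<open>u\<^sub>0\<close> makes \<open>u\<^sub>0\<close>, \<open>u\<^sub>0'\<close>, \<open>u\<^sub>0''\<close>
  decay exponentially.
\<close>

section \<open>Convolution over a half line\<close>

lemma continuous_imp_lebesgue_measurable:
  fixes f :: "real \<Rightarrow> 'b::topological_space"
  assumes "continuous_on UNIV f"
  shows "f \<in> borel_measurable lebesgue"
  using borel_measurable_continuous_onI[OF assms] by (intro measurable_completion) simp

lemma set_integral_exp_atMost:
  fixes b x :: real
  assumes b: "0 < b"
  shows "set_integrable lebesgue {..x} (\<lambda>t. exp (b * t))"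
    and "(LINT t:{..x}|lebesgue. exp (b * t)) = exp (b * x) / b"
proof -
  have "((\<lambda>s. - exp (- b * s) / b) \<longlongrightarrow> - 0 / b) at_top"
    using b by (intro tendsto_intros filterlim_compose[OF exp_at_bot]
        filterlim_tendsto_neg_mult_at_bot[of _ "- b"] filterlim_ident) auto
  then have lim0: "((\<lambda>s. - (exp (- (b * s)) / b)) \<longlongrightarrow> 0) at_top"
    by simp
  \<comment> \<open>The reflection t = - s moves the integral to a half line that is unbounded
    above, where the fundamental theorem applies with the limit \<open>lim0\<close>.\<close>
  have "(\<integral>\<^sup>+t. ennreal (exp (b * t)) * indicator {..x} t \<partial>lborel)
      = (\<integral>\<^sup>+s. ennreal (exp (- b * s)) * indicator {-x..} s \<partial>lborel)"
    by (subst nn_integral_real_affine[where c="-1" and t=0])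
       (auto intro!: nn_integral_cong split: split_indicator)
  also have "\<dots> = ennreal (0 - (- exp (- b * (-x)) / b))"
    using b by (intro nn_integral_FTC_atLeast)
      (auto intro!: derivative_eq_intros lim0)
  finally have nn: "(\<integral>\<^sup>+t. ennreal (indicator {..x} t * exp (b * t)) \<partial>lebesgue) = ennreal (exp (b * x) / b)"
    by (simp add: nn_integral_completion indicator_mult_ennreal mult.commute)
  have meas: "(\<lambda>t. indicator {..x} t * exp (b * t)) \<in> borel_measurable lebesgue"
    by (intro measurable_completion) auto
  have "has_bochner_integral lebesgue (\<lambda>t. indicator {..x} t * exp (b * t)) (exp (b * x) / b)"
    using b nn meas by (intro has_bochner_integral_nn_integral) auto
  then show "set_integrable lebesgue {..x} (\<lambda>t. exp (b * t))"
    and "(LINT t:{..x}|lebesgue. exp (b * t)) = exp (b * x) / b"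
    unfolding set_integrable_def set_lebesgue_integral_def
    by (auto simp: has_bochner_integral_iff)
qed

definition half_conv :: "(real \<Rightarrow> complex) \<Rightarrow> (real \<Rightarrow> complex) \<Rightarrow> real \<Rightarrow> complex" where
  "half_conv k g x = (LINT t:{..x}|lebesgue. k (x - t) * g t)"

text \<open>Extension by zero to negative arguments. It moves the variable endpoint \<open>x\<close>
  of the integral into the integrand, so that all integrals with \<open>x \<le> B\<close> live on
  one half line and dominated convergence applies.\<close>

definition cutoff :: "(real \<Rightarrow> complex) \<Rightarrow> real \<Rightarrow> complex" where
  "cutoff k s = (if 0 \<le> s then k s else 0)"

lemma half_conv_cutoff:
  assumes "x \<le> B"
  shows "half_conv k g x = (LINT t:{..B}|lebesgue. cutoff k (x - t) * g t)"
  unfolding half_conv_def set_lebesgue_integral_def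
  using assms by (intro Bochner_Integration.integral_cong) (auto simp: cutoff_def split: split_indicator)

lemma cutoff_measurable:
  assumes "continuous_on UNIV k"
  shows "(\<lambda>t. cutoff k (x - t)) \<in> borel_measurable lebesgue"
proof -
  have "continuous_on UNIV (\<lambda>t. k (x - t))"
    using assms by (intro continuous_on_compose2[OF assms] continuous_intros) auto
  then have "(\<lambda>t. indicator {..x} t *\<^sub>R k (x - t)) \<in> borel_measurable lebesgue"
    by (intro borel_measurable_scaleR borel_measurable_indicator
        continuous_imp_lebesgue_measurable) auto
  also have "(\<lambda>t. indicator {..x} t *\<^sub>R k (x - t)) = (\<lambda>t. cutoff k (x - t))"
    by (auto simp: cutoff_def fun_eq_iff split: split_indicator)
  finally show ?thesis .
qed

lemma set_integrable_bounded_mult: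
  fixes f g :: "real \<Rightarrow> complex"
  assumes f: "f \<in> borel_measurable lebesgue" and g: "set_integrable lebesgue {..B} g"
    and bd: "\<And>t. t \<le> B \<Longrightarrow> norm (f t) \<le> C"
  shows "set_integrable lebesgue {..B} (\<lambda>t. f t * g t)"
proof -
  have "set_integrable lebesgue {..B} (\<lambda>t. complex_of_real C * g t)"
    using g by simp
  then show ?thesis
  proof (rule set_integrable_bound)
    have "(\<lambda>t. f t * (indicator {..B} t *\<^sub>R g t)) \<in> borel_measurable lebesgue"
      using f g unfolding set_integrable_def by (intro borel_measurable_times) auto
    then show "set_borel_measurable lebesgue {..B} (\<lambda>t. f t * g t)"
      unfolding set_borel_measurable_def by (simp add: mult_ac)
    have "norm (f t * g t) \<le> norm (complex_of_real C * g t)" if "t \<le> B" for t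
      using bd[OF that] abs_ge_self[of C] unfolding norm_mult norm_of_real
      by (intro mult_right_mono) (auto intro: order_trans)
    then show "AE t in lebesgue. t \<in> {..B} \<longrightarrow> norm (f t * g t) \<le> norm (complex_of_real C * g t)"
      by auto
  qed
qed

section \<open>Continuity and differentiation under the integral sign\<close>

lemma AE_lebesgue_neq: "AE t in lebesgue. t \<noteq> (x::real)"
  by (rule AE_not_in[of "{x}", simplified]) simp

text \<open>Provides the common endpoint \<open>B\<close> for the integrals along a sequence and for
  the integral at its limit.\<close>

lemma convergent_bounded_above:
  fixes X :: "nat \<Rightarrow> real"
  assumes "X \<longlonglongrightarrow> x"
  obtains B where "\<And>n. X n \<le> B" "x \<le> B"
proof -
  obtain K where "\<forall>n. norm (X n) \<le> K"
    using convergent_imp_Bseq[OF convergentI[OF assms]] unfolding Bseq_def by blast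
  then have "X n \<le> K" for n
    using abs_le_D1[of "X n" K] by simp
  then have "X n \<le> max K x" for n
    by (simp add: le_max_iff_disj)
  then show ?thesis using that[of "max K x"] by auto
qed

text \<open>Difference quotients can be tested along sequences, the setting in which dominated
  convergence is available.\<close>

lemma has_vector_derivative_iff_quotient:
  "(f has_vector_derivative D) (at x) \<longleftrightarrow> ((\<lambda>y. (f y - f x) /\<^sub>R (y - x)) \<longlongrightarrow> D) (at x)"
proof -
  have "((\<lambda>y. norm (f y - f x - (y - x) *\<^sub>R D) / norm (y - x)) \<longlongrightarrow> 0) (at x)
      \<longleftrightarrow> ((\<lambda>y. norm ((f y - f x) /\<^sub>R (y - x) - D)) \<longlongrightarrow> 0) (at x)"
  proof (intro filterlim_cong refl)
    have "norm (f y - f x - (y - x) *\<^sub>R D) / norm (y - x) = norm ((f y - f x) /\<^sub>R (y - x) - D)"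
      if "y \<noteq> x" for y
    proof -
      have "(f y - f x) /\<^sub>R (y - x) - D = (f y - f x - (y - x) *\<^sub>R D) /\<^sub>R (y - x)"
        using that by (simp add: scaleR_diff_right)
      then show ?thesis by (simp add: divide_inverse mult.commute)
    qed
    then show "\<forall>\<^sub>F y in at x. norm (f y - f x - (y - x) *\<^sub>R D) / norm (y - x)
        = norm ((f y - f x) /\<^sub>R (y - x) - D)"
      by (auto simp: eventually_at_filter)
  qed
  then show ?thesis
    unfolding has_vector_derivative_def has_derivative_iff_norm
    by (simp add: bounded_linear_scaleR_left tendsto_norm_zero_iff LIM_zero_iff)
qed

text \<open>Dominated convergence along sequences, with dominating function
  \<open>C * norm (g t)\<close>.\<close>

lemma half_conv_continuous:
  assumes k: "continuous_on UNIV k" and C: "\<And>s. 0 \<le> s \<Longrightarrow> norm (k s) \<le> C"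
    and g: "\<And>B. set_integrable lebesgue {..B} g"
  shows "continuous_on UNIV (half_conv k g)"
proof -
  have C0: "0 \<le> C" using C[of 0] norm_ge_zero[of "k 0"] by linarith
  have "isCont (half_conv k g) x" for x
    unfolding continuous_at_sequentially
  proof (intro allI impI)
    fix X assume X: "X \<longlonglongrightarrow> x"
    obtain B where B: "\<And>n. X n \<le> B" "x \<le> B"
      using convergent_bounded_above[OF X] by blast
    let ?s = "\<lambda>y t. indicator {..B} t *\<^sub>R (cutoff k (y - t) * g t)"
    have gi: "integrable lebesgue (\<lambda>t. indicator {..B} t *\<^sub>R g t)"
      using g[of B] unfolding set_integrable_def .
    have meas: "?s y \<in> borel_measurable lebesgue" for y
    proof -
      have "(\<lambda>t. cutoff k (y - t) * (indicator {..B} t *\<^sub>R g t)) \<in> borel_measurable lebesgue"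
        using gi by (intro borel_measurable_times cutoff_measurable[OF k]) auto
      then show ?thesis by (simp add: mult_ac)
    qed
    have "(\<lambda>n. integral\<^sup>L lebesgue (?s (X n))) \<longlonglongrightarrow> integral\<^sup>L lebesgue (?s x)"
    proof (rule integral_dominated_convergence)
      show "integrable lebesgue (\<lambda>t. C * norm (indicator {..B} t *\<^sub>R g t))"
        by (intro integrable_mult_right integrable_norm gi)
      show "AE t in lebesgue. norm (?s (X n) t) \<le> C * norm (indicator {..B} t *\<^sub>R g t)" for n
        using C C0 by (intro AE_I2) (auto simp: cutoff_def norm_mult split: split_indicator intro!: mult_right_mono)
      show "AE t in lebesgue. (\<lambda>n. ?s (X n) t) \<longlonglongrightarrow> ?s x t"
        \<comment> \<open>The cutoff kernel may jump at 0, so pointwise convergence can fail at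
          \<open>t = x\<close>; this is a null set.\<close>
        using AE_lebesgue_neq[of x]
      proof eventually_elim
        case (elim t)
        have "(\<lambda>n. cutoff k (X n - t)) \<longlonglongrightarrow> cutoff k (x - t)"
        proof (cases "t < x")
          case True
          have "(\<lambda>n. k (X n - t)) \<longlonglongrightarrow> k (x - t)"
            using k X by (intro isCont_tendsto_compose[of _ k] tendsto_intros)
              (auto simp: continuous_on_eq_continuous_at)
          moreover have "\<forall>\<^sub>F n in sequentially. k (X n - t) = cutoff k (X n - t)"
            using order_tendstoD(1)[OF X True] by eventually_elim (auto simp: cutoff_def)
          ultimately have "(\<lambda>n. cutoff k (X n - t)) \<longlonglongrightarrow> k (x - t)"
            by (rule Lim_transform_eventually)
          then show ?thesis using True by (simp add: cutoff_def)
        next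
          case False
          then have "x < t" using elim by auto
          have "\<forall>\<^sub>F n in sequentially. cutoff k (X n - t) = 0"
            using order_tendstoD(2)[OF X \<open>x < t\<close>] by eventually_elim (auto simp: cutoff_def)
          then have "(\<lambda>n. cutoff k (X n - t)) \<longlonglongrightarrow> 0" by (rule tendsto_eventually)
          then show ?thesis using \<open>x < t\<close> by (simp add: cutoff_def)
        qed
        then show ?case by (intro tendsto_intros)
      qed
    qed (use meas in auto)
    then show "(half_conv k g \<circ> X) \<longlonglongrightarrow> half_conv k g x"
      using B by (simp add: comp_def half_conv_cutoff[of _ B] set_lebesgue_integral_def)
  qed
  then show ?thesis by (simp add: continuous_on_eq_continuous_at)
qed

text \<open>The right-hand side does not depend on \<open>x\<close>. With \<open>X = 0\<close> this
  bounds the solution and its derivatives on the negative half line.\<close>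

lemma norm_half_conv_le:
  assumes k: "continuous_on UNIV k" and C: "\<And>s. 0 \<le> s \<Longrightarrow> norm (k s) \<le> C"
    and g: "set_integrable lebesgue {..X} g" and "x \<le> X"
  shows "norm (half_conv k g x) \<le> (LINT t:{..X}|lebesgue. C * norm (g t))"
proof -
  have C0: "0 \<le> C" using C[of 0] norm_ge_zero[of "k 0"] by linarith
  have kg: "set_integrable lebesgue {..X} (\<lambda>t. cutoff k (x - t) * g t)"
    by (rule set_integrable_bounded_mult[OF cutoff_measurable[OF k] g, of x C])
      (use C C0 in \<open>auto simp: cutoff_def\<close>)
  have h: "set_integrable lebesgue {..X} (\<lambda>t. C * norm (g t))"
    using set_integrable_norm[OF g] by simp
  have "norm (cutoff k (x - t) * g t) \<le> C * norm (g t)" for t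
    using C C0 by (auto simp: norm_mult cutoff_def intro!: mult_right_mono)
  then show ?thesis
    unfolding half_conv_cutoff[OF \<open>x \<le> X\<close>] set_lebesgue_integral_def
    by (intro Bochner_Integration.integral_norm_bound_integral[OF kg[unfolded set_integrable_def] h[unfolded set_integrable_def]])
      (auto split: split_indicator)
qed

text \<open>Since \<open>k 0 = 0\<close>, the moving endpoint contributes no boundary term, and the
  cutoff kernel is Lipschitz on the whole line. Its difference quotients are therefore bounded by
  \<open>L\<close>, which gives the dominating function \<open>L * norm (g t)\<close>.\<close>

lemma half_conv_has_vector_derivative:
  assumes k: "\<And>s. (k has_vector_derivative k' s) (at s)" and k0: "k 0 = 0"
    and C: "\<And>s. 0 \<le> s \<Longrightarrow> norm (k s) \<le> C"
    and k': "continuous_on UNIV k'" and L: "\<And>s. 0 \<le> s \<Longrightarrow> norm (k' s) \<le> L"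
    and g: "\<And>B. set_integrable lebesgue {..B} g"
  shows "(half_conv k g has_vector_derivative half_conv k' g x) (at x)"
proof -
  have kc: "continuous_on UNIV k"
    using k has_vector_derivative_continuous continuous_at_imp_continuous_on by blast
  have L0: "0 \<le> L" using L[of 0] norm_ge_zero[of "k' 0"] by linarith
  \<comment> \<open>Mean value inequality on \<open>{0..}\<close>, where \<open>k'\<close> is
    bounded by \<open>L\<close>.\<close>
  have Lip0: "norm (k s - k r) \<le> L * norm (s - r)" if "0 \<le> s" "0 \<le> r" for s r
  proof (rule differentiable_bound[of "{0..}" k "\<lambda>s h. h *\<^sub>R k' s" L])
    show "(k has_derivative (\<lambda>h. h *\<^sub>R k' s)) (at s within {0..})" for s
      using has_vector_derivative_at_within[OF k] unfolding has_vector_derivative_def .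
    show "onorm (\<lambda>h. h *\<^sub>R k' s) \<le> L" if "s \<in> {0..}" for s
      using L[of s] that by (intro onorm_le) (auto simp: mult.commute[of L] intro!: mult_left_mono)
  qed (use that in auto)
  \<comment> \<open>For arguments of opposite sign, the nonnegative one is compared with 0, where
    \<open>k\<close> vanishes.\<close>
  have Lip: "norm (cutoff k s - cutoff k r) \<le> L * norm (s - r)" for s r
  proof (cases "0 \<le> s"; cases "0 \<le> r")
    assume "0 \<le> s" "\<not> 0 \<le> r"
    have "L * \<bar>s\<bar> \<le> L * \<bar>s - r\<bar>" using \<open>0 \<le> s\<close> \<open>\<not> 0 \<le> r\<close> L0 by (intro mult_left_mono) auto
    with Lip0[of s 0] \<open>0 \<le> s\<close> \<open>\<not> 0 \<le> r\<close> k0 show ?thesis by (simp add: cutoff_def)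
  next
    assume "\<not> 0 \<le> s" "0 \<le> r"
    have "L * \<bar>r\<bar> \<le> L * \<bar>s - r\<bar>" using \<open>0 \<le> r\<close> \<open>\<not> 0 \<le> s\<close> L0 by (intro mult_left_mono) auto
    with Lip0[of r 0] \<open>0 \<le> r\<close> \<open>\<not> 0 \<le> s\<close> k0 show ?thesis by (simp add: cutoff_def)
  qed (use Lip0 L0 in \<open>auto simp: cutoff_def\<close>)
  have "((\<lambda>y. (half_conv k g y - half_conv k g x) /\<^sub>R (y - x)) \<longlongrightarrow> half_conv k' g x) (at x)"
    unfolding tendsto_at_iff_sequentially
  proof (intro allI impI)
    fix X assume X: "X \<longlonglongrightarrow> x" and Xne: "\<forall>i. X i \<in> UNIV - {x}"
    obtain B where B: "\<And>n. X n \<le> B" "x \<le> B"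
      using convergent_bounded_above[OF X] by blast
    let ?s = "\<lambda>y t. indicator {..B} t *\<^sub>R (cutoff k (y - t) * g t)"
    let ?d = "\<lambda>n t. (?s (X n) t - ?s x t) /\<^sub>R (X n - x)"
    let ?l = "\<lambda>t. indicator {..B} t *\<^sub>R (cutoff k' (x - t) * g t)"
    have gi: "integrable lebesgue (\<lambda>t. indicator {..B} t *\<^sub>R g t)"
      using g[of B] unfolding set_integrable_def .
    have gm: "(\<lambda>t. indicator {..B} t *\<^sub>R g t) \<in> borel_measurable lebesgue" using gi by auto
    have meas: "?s y \<in> borel_measurable lebesgue" for y
    proof -
      have "(\<lambda>t. cutoff k (y - t) * (indicator {..B} t *\<^sub>R g t)) \<in> borel_measurable lebesgue"
        using gm by (intro borel_measurable_times cutoff_measurable[OF kc]) auto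
      then show ?thesis by (simp add: mult_ac)
    qed
    have meas': "?l \<in> borel_measurable lebesgue"
    proof -
      have "(\<lambda>t. cutoff k' (x - t) * (indicator {..B} t *\<^sub>R g t)) \<in> borel_measurable lebesgue"
        using gm by (intro borel_measurable_times cutoff_measurable[OF k']) auto
      then show ?thesis by (simp add: mult_ac)
    qed
    have C0: "0 \<le> C" using C[of 0] norm_ge_zero[of "k 0"] by linarith
    have int: "integrable lebesgue (?s y)" for y
      using set_integrable_bounded_mult[OF cutoff_measurable[OF kc] g, of B y C] C C0
      by (auto simp: set_integrable_def cutoff_def)
    have d_eq: "?d n t = ((cutoff k (X n - t) - cutoff k (x - t)) /\<^sub>R (X n - x)) * (indicator {..B} t *\<^sub>R g t)" for n t
      by (cases "t \<in> {..B}") (simp_all add: left_diff_distrib)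
    have "(\<lambda>n. integral\<^sup>L lebesgue (?d n)) \<longlonglongrightarrow> integral\<^sup>L lebesgue ?l"
    proof (rule integral_dominated_convergence)
      show "integrable lebesgue (\<lambda>t. L * norm (indicator {..B} t *\<^sub>R g t))"
        by (intro integrable_mult_right integrable_norm gi)
      show "AE t in lebesgue. norm (?d n t) \<le> L * norm (indicator {..B} t *\<^sub>R g t)" for n
      proof (intro AE_I2)
        fix t
        have "norm ((cutoff k (X n - t) - cutoff k (x - t)) /\<^sub>R (X n - x)) \<le> L"
          using Lip[of "X n - t" "x - t"] Xne
          by (simp add: divide_inverse_commute[symmetric] pos_divide_le_eq del: scaleR_diff_right)
        then have "norm ((cutoff k (X n - t) - cutoff k (x - t)) /\<^sub>R (X n - x)) * norm (indicator {..B} t *\<^sub>R g t)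
            \<le> L * norm (indicator {..B} t *\<^sub>R g t)"
          by (intro mult_right_mono) auto
        then show "norm (?d n t) \<le> L * norm (indicator {..B} t *\<^sub>R g t)"
          unfolding d_eq norm_mult .
      qed
      show "AE t in lebesgue. (\<lambda>n. ?d n t) \<longlonglongrightarrow> ?l t"
        \<comment> \<open>The cutoff kernel may have a corner at 0, so \<open>t = x\<close> is left
          out again.\<close>
        using AE_lebesgue_neq[of x]
      proof eventually_elim
        case (elim t)
        have "(\<lambda>n. (cutoff k (X n - t) - cutoff k (x - t)) /\<^sub>R (X n - x)) \<longlonglongrightarrow> cutoff k' (x - t)"
        proof (cases "t < x")
          case True
          have "((\<lambda>y. (k y - k (x - t)) /\<^sub>R (y - (x - t))) \<longlongrightarrow> k' (x - t)) (at (x - t))"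
            using k has_vector_derivative_iff_quotient by blast
          then have "(\<lambda>n. (k (X n - t) - k (x - t)) /\<^sub>R (X n - t - (x - t))) \<longlonglongrightarrow> k' (x - t)"
            using Xne X unfolding tendsto_at_iff_sequentially comp_def
            by (elim allE[of _ "\<lambda>n. X n - t"]) (auto intro!: tendsto_intros)
          moreover have "\<forall>\<^sub>F n in sequentially. (k (X n - t) - k (x - t)) /\<^sub>R (X n - t - (x - t))
              = (cutoff k (X n - t) - cutoff k (x - t)) /\<^sub>R (X n - x)"
            using order_tendstoD(1)[OF X True]
            by eventually_elim (use True in \<open>auto simp: cutoff_def\<close>)
          ultimately have "(\<lambda>n. (cutoff k (X n - t) - cutoff k (x - t)) /\<^sub>R (X n - x)) \<longlonglongrightarrow> k' (x - t)"
            by (rule Lim_transform_eventually)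
          then show ?thesis using True by (simp add: cutoff_def)
        next
          case False
          then have "x < t" using elim by auto
          have "\<forall>\<^sub>F n in sequentially. (cutoff k (X n - t) - cutoff k (x - t)) /\<^sub>R (X n - x) = 0"
            using order_tendstoD(2)[OF X \<open>x < t\<close>]
            by eventually_elim (use \<open>x < t\<close> in \<open>auto simp: cutoff_def\<close>)
          then have "(\<lambda>n. (cutoff k (X n - t) - cutoff k (x - t)) /\<^sub>R (X n - x)) \<longlonglongrightarrow> 0"
            by (rule tendsto_eventually)
          then show ?thesis using \<open>x < t\<close> by (simp add: cutoff_def)
        qed
        then have "(\<lambda>n. ?d n t) \<longlonglongrightarrow> cutoff k' (x - t) * (indicator {..B} t *\<^sub>R g t)"
          unfolding d_eq by (intro tendsto_intros)
        then show ?case by (simp only: mult_scaleR_right)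
      qed
    qed (use meas meas' in auto)
    moreover have "integral\<^sup>L lebesgue (?d n) = (half_conv k g (X n) - half_conv k g x) /\<^sub>R (X n - x)" for n
      using B int by (simp add: half_conv_cutoff[of _ B] set_lebesgue_integral_def)
    ultimately have "(\<lambda>n. (half_conv k g (X n) - half_conv k g x) /\<^sub>R (X n - x))
        \<longlonglongrightarrow> integral\<^sup>L lebesgue ?l"
      by (simp only:)
    also have "integral\<^sup>L lebesgue ?l = half_conv k' g x"
      using B by (simp add: half_conv_cutoff[of _ B] set_lebesgue_integral_def)
    finally show "((\<lambda>y. (half_conv k g y - half_conv k g x) /\<^sub>R (y - x)) \<circ> X) \<longlonglongrightarrow> half_conv k' g x"
      by (simp only: comp_def)
  qed
  then show ?thesis by (simp add: has_vector_derivative_iff_quotient)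
qed

section \<open>Neumann series of a Volterra operator\<close>

text \<open>Ratio test: consecutive terms have a quotient of modulus |d| / sqrt(n + 1), which is at
  most 1/2 once n is at least 4 d^2.\<close>

lemma summable_power_div_sqrt_fact: "summable (\<lambda>n. d ^ n / sqrt (fact n))" for d :: real
proof -
  obtain N :: nat where N: "4 * d\<^sup>2 \<le> real N"
    using real_arch_simple by blast
  show ?thesis
  proof (rule summable_ratio_test[of "1/2" N])
    fix n assume "N \<le> n"
    then have "(2 * \<bar>d\<bar>)\<^sup>2 \<le> 1 + real n"
      using N by (simp add: power_mult_distrib)
    then have "2 * \<bar>d\<bar> \<le> sqrt (1 + real n)"
      by (rule real_le_rsqrt)
    then have "\<bar>d\<bar> / sqrt (1 + real n) \<le> 1 / 2"
      by (simp add: divide_le_eq)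
    then have "\<bar>d\<bar> / sqrt (1 + real n) * (\<bar>d\<bar> ^ n / sqrt (fact n)) \<le> 1 / 2 * (\<bar>d\<bar> ^ n / sqrt (fact n))"
      by (intro mult_right_mono) auto
    then show "norm (d ^ Suc n / sqrt (fact (Suc n))) \<le> 1/2 * norm (d ^ n / sqrt (fact n))"
      by (simp add: real_sqrt_mult abs_mult power_abs)
  qed simp
qed

text \<open>The weighted integrability is asked on every half line, not only on the negative one,
  because the solution and its integral equation are needed at every real point. In the application
  \<open>k\<close> is the Jost kernel multiplied by w.\<close>

locale volterra =
  fixes q :: "real \<Rightarrow> real" and a C :: real and k :: "real \<Rightarrow> complex"
  assumes a_pos: "0 < a"
    and q_meas: "q \<in> borel_measurable lebesgue"
    and q_L2: "\<And>X. set_integrable lebesgue {..X} (\<lambda>t. (q t)\<^sup>2 * exp (- (2 * a * t)))"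
    and k_cont: "continuous_on UNIV k"
    and k_bound: "\<And>s. 0 \<le> s \<Longrightarrow> norm (k s) \<le> C"
begin

definition V :: "(real \<Rightarrow> complex) \<Rightarrow> real \<Rightarrow> complex" where
  "V f = half_conv k (\<lambda>t. complex_of_real (q t) * f t)"

text \<open>The constant left by the weighted inequality in \<open>q_exp_integral\<close>: half the
  weighted square integral of \<open>q\<close>, plus half of the 1/(2a) that comes from integrating
  the exponential.\<close>

definition rate :: "real \<Rightarrow> real" where
  "rate X = ((LINT t:{..X}|lebesgue. (q t)\<^sup>2 * exp (- (2 * a * t))) + 1 / (2 * a)) / 2"

lemma C_nonneg: "0 \<le> C"
  using k_bound[of 0] norm_ge_zero[of "k 0"] by linarith

lemma rate_nonneg: "0 \<le> rate X"
  unfolding rate_def set_lebesgue_integral_def using a_pos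
  by (intro divide_nonneg_nonneg add_nonneg_nonneg Bochner_Integration.integral_nonneg) auto

lemma q_exp_integral:
  assumes "x \<le> X"
  shows "set_integrable lebesgue {..x} (\<lambda>t. \<bar>q t\<bar> * exp (real n * a * t))" (is ?int)
    and "(LINT t:{..x}|lebesgue. \<bar>q t\<bar> * exp (real n * a * t))
           \<le> rate X * (exp (real (Suc n) * a * x) / sqrt (real (Suc n)))" (is ?bound)
proof -
  \<comment> \<open>The Cauchy-Schwarz inequality for \<open>q exp(- a t)\<close> and \<open>exp((n + 1) a t)\<close>, in the form
    \<open>2 A B \<le> e A\<^sup>2 + B\<^sup>2 / e\<close> with a weight \<open>e\<close> that balances the two integrals.\<close>
  define b where "b = 2 * real (Suc n) * a"
  define e where "e = exp (real (Suc n) * a * x) / sqrt (real (Suc n))"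
  have e: "0 < e" and b: "0 < b" using a_pos by (auto simp: e_def b_def)
  let ?Q = "\<lambda>t. (q t)\<^sup>2 * exp (- (2 * a * t))"
  let ?G = "\<lambda>t. (e * ?Q t + (1 / e) * exp (b * t)) / 2"
  have G: "set_integrable lebesgue {..x} ?G"
    using q_L2[of x] set_integral_exp_atMost(1)[OF b, of x] by (intro set_integrable_divide set_integral_add(1)) auto
  have le: "\<bar>q t\<bar> * exp (real n * a * t) \<le> ?G t" for t
  proof -
    define A where "A = \<bar>q t\<bar> * exp (- (a * t))"
    define B where "B = exp (real (Suc n) * a * t)"
    have "A * B = \<bar>q t\<bar> * exp (real n * a * t)"
      unfolding A_def B_def by (simp add: exp_add[symmetric] algebra_simps)
    moreover have "A\<^sup>2 = ?Q t" "B\<^sup>2 = exp (b * t)"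
      unfolding A_def B_def b_def by (simp_all add: power_mult_distrib exp_double[symmetric] mult_ac)
    moreover have "2 * e * (A * B) \<le> (e * A)\<^sup>2 + B\<^sup>2"
      using sum_squares_bound[of "e * A" B] by (simp add: mult_ac)
    then have "A * B \<le> (e * A\<^sup>2 + (1 / e) * B\<^sup>2) / 2"
      using e by (simp add: field_simps power2_eq_square)
    ultimately show ?thesis by simp
  qed
  show ?int
  proof (rule set_integrable_bound[OF G])
    show "set_borel_measurable lebesgue {..x} (\<lambda>t. \<bar>q t\<bar> * exp (real n * a * t))"
      unfolding set_borel_measurable_def
      by (intro borel_measurable_scaleR borel_measurable_times borel_measurable_abs
          borel_measurable_indicator q_meas
          continuous_imp_lebesgue_measurable[of "\<lambda>t. exp (real n * a * t)"] continuous_intros) auto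
    show "AE t in lebesgue. t \<in> {..x} \<longrightarrow> norm (\<bar>q t\<bar> * exp (real n * a * t)) \<le> norm (?G t)"
      using le by (intro AE_I2) (smt (verit) exp_gt_zero mult_nonneg_nonneg real_norm_def)
  qed
  then have "(LINT t:{..x}|lebesgue. \<bar>q t\<bar> * exp (real n * a * t)) \<le> (LINT t:{..x}|lebesgue. ?G t)"
    using G le by (intro set_integral_mono) auto
  also have "\<dots> = (e * (LINT t:{..x}|lebesgue. ?Q t) + (1 / e) * (LINT t:{..x}|lebesgue. exp (b * t))) / 2"
    using q_L2[of x] set_integral_exp_atMost(1)[OF b, of x]
    by (subst set_integral_divide_zero, subst set_integral_add(2)) auto
  also have "(1 / e) * (LINT t:{..x}|lebesgue. exp (b * t)) = e * (1 / (2 * a))"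
  proof -
    have "e * e * real (Suc n) = exp (b * x)"
      by (simp add: e_def b_def mult_exp_exp field_simps)
    then have "exp (b * x) / b = (e * e * real (Suc n)) / (2 * real (Suc n) * a)"
      by (simp only: b_def)
    also have "\<dots> = e * e * (1 / (2 * a))"
      by (simp add: divide_simps del: of_nat_Suc)
    finally have "exp (b * x) / b = e * e * (1 / (2 * a))" .
    then show ?thesis
      unfolding set_integral_exp_atMost(2)[OF b] using e by simp
  qed
  \<comment> \<open>The integral of the nonnegative \<open>?Q\<close> grows with the endpoint;
    passing from \<open>x\<close> to \<open>X\<close> makes the constant uniform in
    \<open>x \<le> X\<close>.\<close>
  also have "(e * (LINT t:{..x}|lebesgue. ?Q t) + e * (1 / (2 * a))) / 2 \<le> e * rate X"
  proof -
    have "(LINT t:{..x}|lebesgue. ?Q t) \<le> (LINT t:{..X}|lebesgue. ?Q t)"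
      using q_L2[of x] q_L2[of X] assms unfolding set_integrable_def set_lebesgue_integral_def
      by (intro integral_mono) (auto split: split_indicator)
    then show ?thesis
      using e unfolding rate_def by (simp add: field_simps)
  qed
  finally show ?bound by (simp add: e_def mult.commute)
qed

section \<open>Mapping properties of the Volterra operator\<close>

lemma q_mult_integrable:
  assumes f: "f \<in> borel_measurable lebesgue" and bd: "\<And>t. t \<le> X \<Longrightarrow> norm (f t) \<le> B"
  shows "set_integrable lebesgue {..X} (\<lambda>t. complex_of_real (q t) * f t)"
proof -
  \<comment> \<open>Order 0 of the exponential estimate: \<open>q\<close> itself is integrable on
    half lines.\<close>
  have "set_integrable lebesgue {..X} (\<lambda>t. complex_of_real (q t))"
    using q_exp_integral(1)[of X X 0]
  proof (rule set_integrable_bound)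
    have "(\<lambda>t. complex_of_real (q t)) \<in> borel_measurable lebesgue"
      using q_meas by measurable
    then show "set_borel_measurable lebesgue {..X} (\<lambda>t. complex_of_real (q t))"
      unfolding set_borel_measurable_def
      by (intro borel_measurable_scaleR borel_measurable_indicator) auto
  qed auto
  from set_integrable_bounded_mult[OF f this bd] show ?thesis
    by (simp add: mult.commute)
qed

text \<open>The inductive step of the Neumann estimate. The order of the exponential rises by one,
  and the factors 1 / sqrt(n + 1) accumulate to 1 / sqrt(n!).\<close>

lemma norm_V_le:
  assumes f: "f \<in> borel_measurable lebesgue"
    and bd: "\<And>t. t \<le> X \<Longrightarrow> norm (f t) \<le> c * exp (real n * a * t)" and "0 \<le> c" "x \<le> X"
  shows "norm (V f x) \<le> C * c * (rate X * (exp (real (Suc n) * a * x) / sqrt (real (Suc n))))"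
proof -
  let ?h = "\<lambda>t. C * c * (\<bar>q t\<bar> * exp (real n * a * t))"
  \<comment> \<open>A constant bound is enough for integrability; the exponential bound is kept for
    the estimate itself.\<close>
  have bd': "norm (f t) \<le> c * exp (real n * a * x)" if "t \<le> x" for t
    using bd[of t] that assms a_pos
    by (smt (verit) exp_le_cancel_iff mult_left_mono mult_nonneg_nonneg of_nat_0_le_iff)
  have int: "set_integrable lebesgue {..x} (\<lambda>t. complex_of_real (q t) * f t)"
    using f bd' by (rule q_mult_integrable)
  have kf: "set_integrable lebesgue {..x} (\<lambda>t. cutoff k (x - t) * (complex_of_real (q t) * f t))"
    by (rule set_integrable_bounded_mult[OF cutoff_measurable[OF k_cont] int, of x C])
      (auto simp: cutoff_def k_bound)
  have h: "set_integrable lebesgue {..x} ?h"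
    using q_exp_integral(1)[of x X n] assms by (intro set_integrable_mult_right) auto
  have le: "norm (cutoff k (x - t) * (complex_of_real (q t) * f t)) \<le> ?h t" if "t \<le> x" for t
  proof -
    have "norm (k (x - t)) * (\<bar>q t\<bar> * norm (f t)) \<le> C * (\<bar>q t\<bar> * (c * exp (real n * a * t)))"
      using that assms bd[of t] by (intro mult_mono k_bound C_nonneg) auto
    then show ?thesis using that by (simp add: norm_mult cutoff_def mult_ac)
  qed
  have "norm (V f x) \<le> (LINT t:{..x}|lebesgue. ?h t)"
    unfolding V_def half_conv_cutoff[OF order_refl] set_lebesgue_integral_def
    by (rule Bochner_Integration.integral_norm_bound_integral[OF kf[unfolded set_integrable_def] h[unfolded set_integrable_def]])
      (use le in \<open>auto split: split_indicator\<close>)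
  also have "\<dots> = C * c * (LINT t:{..x}|lebesgue. \<bar>q t\<bar> * exp (real n * a * t))"
    by simp
  also have "\<dots> \<le> C * c * (rate X * (exp (real (Suc n) * a * x) / sqrt (real (Suc n))))"
    using assms C_nonneg by (intro mult_left_mono q_exp_integral(2)) auto
  finally show ?thesis .
qed

lemma V_continuous:
  assumes f: "f \<in> borel_measurable lebesgue" and bd: "\<And>X. \<exists>B. \<forall>t\<le>X. norm (f t) \<le> B"
  shows "continuous_on UNIV (V f)"
  unfolding V_def
proof (rule half_conv_continuous[OF k_cont k_bound])
  fix X
  obtain B where "\<forall>t\<le>X. norm (f t) \<le> B" using bd by blast
  then show "set_integrable lebesgue {..X} (\<lambda>t. complex_of_real (q t) * f t)"
    by (intro q_mult_integrable[OF f, of X B]) auto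
qed

section \<open>The Neumann iterates and their sum\<close>

definition iter :: "nat \<Rightarrow> real \<Rightarrow> complex" where
  "iter n = (V ^^ n) (\<lambda>_. 1)"

lemma iter_Suc: "iter (Suc n) = V (iter n)"
  by (simp add: iter_def)

text \<open>Both claims run in one induction: applying \<open>V\<close> to \<open>iter n\<close>
  requires its measurability, which comes from continuity, and its boundedness on half lines, which
  comes from the estimate.\<close>

lemma iter_bound_continuous:
  "(\<forall>X. \<forall>x\<le>X. norm (iter n x) \<le> (C * rate X) ^ n / sqrt (fact n) * exp (real n * a * x))
     \<and> continuous_on UNIV (iter n)"
proof (induction n)
  case 0
  then show ?case by (simp add: iter_def)
next
  case (Suc n)
  have meas: "iter n \<in> borel_measurable lebesgue"
    using Suc by (intro continuous_imp_lebesgue_measurable) auto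
  have bd: "norm (iter n x) \<le> (C * rate X) ^ n / sqrt (fact n) * exp (real n * a * x)" if "x \<le> X" for x X
    using Suc that by blast
  have "\<exists>B. \<forall>t\<le>X. norm (iter n t) \<le> B" for X
  proof (intro exI allI impI)
    fix t assume t: "t \<le> X"
    have "(C * rate X) ^ n / sqrt (fact n) * exp (real n * a * t) \<le> (C * rate X) ^ n / sqrt (fact n) * exp (real n * a * X)"
      using t a_pos C_nonneg rate_nonneg by (intro mult_left_mono) (auto intro!: mult_left_mono)
    then show "norm (iter n t) \<le> (C * rate X) ^ n / sqrt (fact n) * exp (real n * a * X)"
      using bd[OF t] by linarith
  qed
  then have "continuous_on UNIV (iter (Suc n))"
    unfolding iter_Suc by (rule V_continuous[OF meas])
  moreover have "norm (iter (Suc n) x) \<le> (C * rate X) ^ Suc n / sqrt (fact (Suc n)) * exp (real (Suc n) * a * x)"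
    if "x \<le> X" for x X
  proof -
    have "norm (iter (Suc n) x) \<le> C * ((C * rate X) ^ n / sqrt (fact n)) *
        (rate X * (exp (real (Suc n) * a * x) / sqrt (real (Suc n))))"
      unfolding iter_Suc using C_nonneg rate_nonneg that
      by (intro norm_V_le[OF meas bd]) auto
    also have "\<dots> = (C * rate X) ^ Suc n / sqrt (fact (Suc n)) * exp (real (Suc n) * a * x)"
      by (simp add: real_sqrt_mult mult_ac)
    finally show ?thesis .
  qed
  ultimately show ?case by blast
qed

text \<open>The iterate bound with the exponential frozen at the endpoint \<open>X\<close>: one
  summable sequence for all \<open>x \<le> X\<close>, as in the Weierstrass test.\<close>

definition majorant :: "real \<Rightarrow> nat \<Rightarrow> real" where
  "majorant X n = (C * rate X * exp (a * X)) ^ n / sqrt (fact n)"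

lemma norm_iter_le_majorant:
  assumes "x \<le> X"
  shows "norm (iter n x) \<le> majorant X n"
proof -
  have "norm (iter n x) \<le> (C * rate X) ^ n / sqrt (fact n) * exp (real n * a * x)"
    using iter_bound_continuous assms by blast
  also have "\<dots> \<le> (C * rate X) ^ n / sqrt (fact n) * exp (real n * a * X)"
    using assms a_pos C_nonneg rate_nonneg by (intro mult_left_mono) (auto intro!: mult_left_mono)
  also have "exp (real n * a * X) = exp (a * X) ^ n"
    by (simp add: exp_of_nat_mult[symmetric] mult_ac)
  finally show ?thesis by (simp add: majorant_def power_mult_distrib mult_ac)
qed

lemma summable_majorant: "summable (majorant X)"
  unfolding majorant_def by (rule summable_power_div_sqrt_fact)

definition neumann :: "real \<Rightarrow> complex" where
  "neumann x = (\<Sum>n. iter n x)"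

lemma iter_summable: "summable (\<lambda>n. iter n x)"
  by (rule summable_comparison_test'[OF summable_majorant[of x], of 0]) (simp add: norm_iter_le_majorant)

lemma iter_measurable: "iter n \<in> borel_measurable lebesgue"
  using iter_bound_continuous by (intro continuous_imp_lebesgue_measurable) blast

lemma neumann_measurable: "neumann \<in> borel_measurable lebesgue"
  unfolding neumann_def[abs_def] using iter_measurable by (rule borel_measurable_suminf)

text \<open>The bound is uniform in \<open>N\<close>. It dominates the partial sums in the proof of
  the integral equation and passes to the sum in the limit.\<close>

lemma norm_sum_iter_le:
  assumes "x \<le> X"
  shows "norm (\<Sum>n<N. iter n x) \<le> suminf (majorant X)"
proof -
  have "norm (\<Sum>n<N. iter n x) \<le> (\<Sum>n<N. majorant X n)"
    using assms by (intro sum_norm_le norm_iter_le_majorant)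
  also have "\<dots> \<le> suminf (majorant X)"
    using norm_iter_le_majorant[OF assms] by (intro sum_le_suminf summable_majorant) (auto intro: order_trans[OF norm_ge_zero])
  finally show ?thesis .
qed

lemma norm_neumann_le:
  assumes "x \<le> X"
  shows "norm (neumann x) \<le> suminf (majorant X)"
  using norm_sum_iter_le[OF assms]
    tendsto_norm[OF summable_LIMSEQ[OF iter_summable[of x]]]
  unfolding neumann_def by (intro LIMSEQ_le_const2) auto

lemma neumann_integrable: "set_integrable lebesgue {..X} (\<lambda>t. complex_of_real (q t) * neumann t)"
  using norm_neumann_le by (intro q_mult_integrable[OF neumann_measurable]) auto

text \<open>The partial sums are uniformly bounded on \<open>{..x}\<close> and \<open>q\<close> is
  integrable there, so dominated convergence lets \<open>V\<close> act term by term on the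
  series.\<close>

lemma neumann_eq: "neumann x = 1 + V neumann x"
proof -
  let ?K = "\<lambda>f t. indicator {..x} t *\<^sub>R (cutoff k (x - t) * (complex_of_real (q t) * f t))"
  have int: "integrable lebesgue (?K f)"
    if "f \<in> borel_measurable lebesgue" "\<And>t. t \<le> x \<Longrightarrow> norm (f t) \<le> B" for f B
    using set_integrable_bounded_mult[OF cutoff_measurable[OF k_cont, of x] q_mult_integrable[OF that], of x C]
    by (auto simp: set_integrable_def cutoff_def k_bound)
  have V: "V f x = integral\<^sup>L lebesgue (?K f)" for f
    by (simp add: V_def half_conv_cutoff[OF order_refl] set_lebesgue_integral_def)
  have q_int: "integrable lebesgue (\<lambda>t. indicator {..x} t *\<^sub>R complex_of_real (q t))"
    using q_mult_integrable[of "\<lambda>_. 1" x 1] by (simp add: set_integrable_def)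
  have iter_int: "integrable lebesgue (?K (iter n))" for n
    by (rule int[OF iter_measurable norm_iter_le_majorant])
  have "(\<lambda>N. integral\<^sup>L lebesgue (?K (\<lambda>t. \<Sum>n<N. iter n t))) \<longlonglongrightarrow> integral\<^sup>L lebesgue (?K neumann)"
  proof (rule integral_dominated_convergence)
    show "integrable lebesgue (\<lambda>t. C * suminf (majorant x) * norm (indicator {..x} t *\<^sub>R complex_of_real (q t)))"
      by (intro integrable_mult_right integrable_norm q_int)
    show "?K neumann \<in> borel_measurable lebesgue"
      by (rule borel_measurable_integrable[OF int[OF neumann_measurable norm_neumann_le]])
    show "?K (\<lambda>t. \<Sum>n<N. iter n t) \<in> borel_measurable lebesgue" for N
      by (rule borel_measurable_integrable[OF int[OF borel_measurable_sum[OF iter_measurable] norm_sum_iter_le]])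
    show "AE t in lebesgue. (\<lambda>N. ?K (\<lambda>t. \<Sum>n<N. iter n t) t) \<longlonglongrightarrow> ?K neumann t"
      unfolding neumann_def
      by (intro AE_I2 tendsto_intros summable_LIMSEQ iter_summable)
    show "AE t in lebesgue. norm (?K (\<lambda>t. \<Sum>n<N. iter n t) t)
        \<le> C * suminf (majorant x) * norm (indicator {..x} t *\<^sub>R complex_of_real (q t))" for N
    proof (intro AE_I2)
      fix t
      show "norm (?K (\<lambda>t. \<Sum>n<N. iter n t) t)
          \<le> C * suminf (majorant x) * norm (indicator {..x} t *\<^sub>R complex_of_real (q t))"
      proof (cases "t \<le> x")
        case True
        then have "norm (cutoff k (x - t)) * (\<bar>q t\<bar> * norm (\<Sum>n<N. iter n t)) \<le> C * (\<bar>q t\<bar> * suminf (majorant x))"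
          using k_bound C_nonneg norm_sum_iter_le[OF True, of N]
          by (intro mult_mono) (auto simp: cutoff_def)
        then show ?thesis using True by (simp add: norm_mult mult_ac)
      qed simp
    qed
  qed
  \<comment> \<open>By linearity, \<open>V\<close> maps the sum of the orders below \<open>N\<close>
    to the sum of the orders from 1 to \<open>N\<close>.\<close>
  moreover have "integral\<^sup>L lebesgue (?K (\<lambda>t. \<Sum>n<N. iter n t)) = (\<Sum>n<N. iter (Suc n) x)" for N
  proof -
    have "?K (\<lambda>t. \<Sum>n<N. iter n t) = (\<lambda>t. \<Sum>n<N. ?K (iter n) t)"
      by (simp only: sum_distrib_left scaleR_sum_right)
    then show ?thesis
      unfolding iter_Suc V by (simp only: Bochner_Integration.integral_sum[OF iter_int])
  qed
  ultimately have "(\<lambda>N. \<Sum>n<N. iter (Suc n) x) \<longlonglongrightarrow> V neumann x"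
    by (simp add: V)
  \<comment> \<open>The shifted series misses only the term of order 0, the constant 1.\<close>
  moreover have "(\<lambda>N. \<Sum>n<N. iter (Suc n) x) \<longlonglongrightarrow> neumann x - iter 0 x"
    unfolding neumann_def sums_def[symmetric]
    using summable_sums[OF iter_summable[of x]]
    by (subst sums_Suc_iff[of "\<lambda>n. iter n x"]) simp
  ultimately have "neumann x - iter 0 x = V neumann x"
    using LIMSEQ_unique by blast
  then show ?thesis by (simp add: iter_def algebra_simps)
qed

end

section \<open>The Jost solution\<close>

lemma zeta_powi:
  "zeta 1 powi (- 2) = zeta 1" "zeta 2 powi (- 2) = zeta 2"
proof -
  \<comment> \<open>For a cube root of unity, z * z^2 = 1. The coefficients in \<open>s2\<close>
    thereby become the roots themselves, which gives the uniform sum in \<open>kern\<close>.\<close>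
  have *: "z powi (- 2) = z" if "z ^ 3 = 1" for z :: complex
  proof -
    have "z * z\<^sup>2 = 1" using that by (simp add: power2_eq_square power3_eq_cube mult.assoc)
    then have "inverse (z\<^sup>2) = z"
      by (metis inverse_unique mult.commute)
    then show ?thesis by (simp add: power_int_minus)
  qed
  have "zeta 1 ^ 3 = 1" "zeta 2 ^ 3 = 1"
    by (simp_all add: zeta_def complex_eq_iff power3_eq_cube field_simps)
  then show "zeta 1 powi (- 2) = zeta 1" "zeta 2 powi (- 2) = zeta 2"
    by (auto intro: *)
qed

text \<open>The derivative of order \<open>p\<close> of \<open>s \<mapsto> exp (- w s) s2 (w s)\<close>.\<close>

definition kern :: "complex \<Rightarrow> nat \<Rightarrow> real \<Rightarrow> complex" where
  "kern w p s = (\<Sum>j<3. zeta j * ((zeta j - 1) * w) ^ p * exp ((zeta j - 1) * w * complex_of_real s)) / 3"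

lemma kern_0_eq: "kern w 0 s = exp (- (w * complex_of_real s)) * s2 (w * complex_of_real s)"
  unfolding kern_def s2_def zeta_powi
  by (simp add: eval_nat_numeral zeta_def[of 0] exp_add[symmetric] exp_diff exp_minus field_simps)

lemma kern_has_vector_derivative: "(kern w p has_vector_derivative kern w (Suc p) s) (at s)"
proof -
  define c where "c j = (zeta j - 1) * w" for j
  \<comment> \<open>The formula is differentiated in a complex variable and then restricted to the
    real line.\<close>
  have *: "((\<lambda>z. zeta j * c j ^ p * exp (c j * z)) has_field_derivative zeta j * c j ^ Suc p * exp (c j * z)) (at z)" for j z
    by (auto intro!: derivative_eq_intros simp: mult_ac)
  have **: "((\<lambda>z. (\<Sum>j<3. zeta j * c j ^ p * exp (c j * z)) / 3) has_field_derivative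
      (\<Sum>j<3. zeta j * c j ^ Suc p * exp (c j * z)) / 3) (at z)" for z
    by (intro DERIV_cdivide DERIV_sum *)
  from has_vector_derivative_real_field[OF **[of "complex_of_real s"], of UNIV]
  show ?thesis
    unfolding c_def kern_def[abs_def] .
qed

lemma kern_continuous: "continuous_on UNIV (kern w p)"
  by (intro continuous_at_imp_continuous_on ballI
      has_vector_derivative_continuous[OF kern_has_vector_derivative])

text \<open>The cube roots of unity sum to 0, and so do their squares. These two zeros are what
  permits two differentiations of the convolution.\<close>

lemma kern_at_0: "kern w 0 0 = 0" "kern w 1 0 = 0"
  by (simp_all add: kern_def eval_nat_numeral zeta_def complex_eq_iff field_simps)

lemma kern_bounded:
  assumes "\<And>j. Re ((zeta j - 1) * w) \<le> 0" and "0 \<le> s"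
  shows "norm (kern w p s) \<le> (\<Sum>j<3. norm (zeta j * ((zeta j - 1) * w) ^ p)) / 3"
proof -
  have "norm (\<Sum>j<3. zeta j * ((zeta j - 1) * w) ^ p * exp ((zeta j - 1) * w * complex_of_real s))
      \<le> (\<Sum>j<3. norm (zeta j * ((zeta j - 1) * w) ^ p))"
  proof (rule sum_norm_le)
    fix j
    have "Re ((zeta j - 1) * w * complex_of_real s) \<le> 0"
      using mult_nonpos_nonneg[OF assms(1)[of j] assms(2)] by (simp del: minus_complex.sel)
    then have "norm (exp ((zeta j - 1) * w * complex_of_real s)) \<le> 1"
      unfolding norm_exp_eq_Re by simp
    then show "norm (zeta j * ((zeta j - 1) * w) ^ p * exp ((zeta j - 1) * w * complex_of_real s))
        \<le> norm (zeta j * ((zeta j - 1) * w) ^ p)"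
      unfolding norm_mult[of _ "exp _"] by (intro mult_left_le) auto
  qed
  then show ?thesis by (simp add: kern_def norm_divide)
qed

text \<open>With - \<lambda> = \<alpha> + i \<beta> and n the cube root of \<open>mm\<close>, the
  number w = i n \<lambda> equals n (\<beta> - i \<alpha>). The nonzero exponents have real parts n
  (sqrt 3 \<alpha> - 3 \<beta>) / 2 and n (- sqrt 3 \<alpha> - 3 \<beta>) / 2; the sector condition
  multiplied by sqrt 3 controls both.\<close>

lemma Omega0_minus_exponents:
  assumes "lam \<in> Omega0_minus" and "0 < mm"
  shows "0 < Re (\<i> * z_minus mm lam)" and "Re ((zeta j - 1) * (\<i> * z_minus mm lam)) \<le> 0"
proof -
  define n where "n = root 3 mm"
  have n: "0 < n" using assms by (simp add: n_def)
  obtain \<alpha> \<beta> where lam: "- lam = Complex \<alpha> \<beta>" and ab: "\<bar>\<alpha>\<bar> < sqrt 3 * \<beta>"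
    using assms unfolding Omega0_minus_def Omega0_def by auto
  then have lam': "Re lam = - \<alpha>" "Im lam = - \<beta>"
    by (auto simp: complex_eq_iff)
  have b: "0 < \<beta>" using ab
    by (smt (verit) mult_nonneg_nonpos real_sqrt_ge_zero)
  show "0 < Re (\<i> * z_minus mm lam)"
    using b n by (simp add: z_minus_def lam' n_def)
  have "sqrt 3 * \<bar>\<alpha>\<bar> \<le> sqrt 3 * (sqrt 3 * \<beta>)"
    using ab by (intro mult_left_mono) auto
  then have ab3: "sqrt 3 * \<bar>\<alpha>\<bar> \<le> 3 * \<beta>" by (simp flip: mult.assoc)
  have ab': "sqrt 3 * \<alpha> \<le> 3 * \<beta>" "- (sqrt 3 * \<alpha>) \<le> 3 * \<beta>"
  proof -
    have "sqrt 3 * \<alpha> \<le> sqrt 3 * \<bar>\<alpha>\<bar>" "sqrt 3 * (- \<alpha>) \<le> sqrt 3 * \<bar>\<alpha>\<bar>"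
      by (intro mult_left_mono; simp)+
    with ab3 show "sqrt 3 * \<alpha> \<le> 3 * \<beta>" "- (sqrt 3 * \<alpha>) \<le> 3 * \<beta>"
      by linarith+
  qed
  \<comment> \<open>\<open>zeta\<close> is constant from index 2 on, so three cases cover every
    \<open>j\<close>.\<close>
  have "Re ((zeta j - 1) * (\<i> * z_minus mm lam)) = n * (if j = 0 then 0 else if j = 1 then (sqrt 3 * \<alpha> - 3 * \<beta>) / 2 else (- (sqrt 3 * \<alpha>) - 3 * \<beta>) / 2)"
    by (simp add: z_minus_def lam' n_def[symmetric] zeta_def field_simps)
  also have "\<dots> \<le> 0"
    using n ab' by (intro mult_nonneg_nonpos) auto
  finally show "Re ((zeta j - 1) * (\<i> * z_minus mm lam)) \<le> 0" .
qed

section \<open>Square integrability on half lines\<close>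

lemma L2_on_exp_mult:
  fixes f :: "real \<Rightarrow> complex"
  assumes f: "continuous_on UNIV f" and bd: "\<And>x. x \<le> 0 \<Longrightarrow> norm (f x) \<le> B" and w: "0 < Re w"
  shows "L2_on {..0} (\<lambda>x. exp (w * complex_of_real x) * f x)"
proof -
  let ?u = "\<lambda>x. exp (w * complex_of_real x) * f x"
  have u: "continuous_on UNIV ?u" by (intro continuous_intros f)
  have "set_integrable lebesgue {..0} (\<lambda>x. B\<^sup>2 * exp (2 * Re w * x))"
    using w set_integral_exp_atMost(1)[of "2 * Re w" 0] by (intro set_integrable_mult_right) auto
  then have "set_integrable lebesgue {..0} (\<lambda>x. (norm (?u x))\<^sup>2)"
  proof (rule set_integrable_bound)
    show "set_borel_measurable lebesgue {..0} (\<lambda>x. (norm (?u x))\<^sup>2)"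
      unfolding set_borel_measurable_def
      by (intro borel_measurable_scaleR borel_measurable_indicator
          continuous_imp_lebesgue_measurable continuous_intros f) auto
    \<comment> \<open>The modulus of exp(w x) is exp(Re w x), which decays at minus infinity because
      Re w is positive.\<close>
    have "(norm (?u x))\<^sup>2 \<le> B\<^sup>2 * exp (2 * Re w * x)" if "x \<le> 0" for x
    proof -
      have "(norm (?u x))\<^sup>2 = exp (2 * Re w * x) * (norm (f x))\<^sup>2"
        by (simp add: norm_mult power_mult_distrib exp_double[symmetric] mult_ac)
      also have "\<dots> \<le> exp (2 * Re w * x) * B\<^sup>2"
        using bd[OF that] by (intro mult_left_mono power_mono) auto
      finally show ?thesis by (simp add: mult.commute)
    qed
    then show "AE x in lebesgue. x \<in> {..0} \<longrightarrow> norm ((norm (?u x))\<^sup>2) \<le> norm (B\<^sup>2 * exp (2 * Re w * x))"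
      by auto
  qed
  moreover have "set_borel_measurable lebesgue {..0} ?u"
    unfolding set_borel_measurable_def
    by (intro borel_measurable_scaleR borel_measurable_indicator
        continuous_imp_lebesgue_measurable u) auto
  ultimately show ?thesis by (simp add: L2_on_def)
qed

text \<open>For negative t the weights agree, and division by \<open>mm\<close> only contributes 1 /
  mm^2. On \<open>{0..X}\<close> the weight exp(- 2 a t) is at most 1, and m - mm = (m - mp) + (mp -
  mm) is a square integrable function plus a constant on a bounded interval.\<close>

lemma weighted_L2_atMost:
  fixes m :: "real \<Rightarrow> real"
  assumes m: "m \<in> borel_measurable lebesgue" and mm: "0 < mm" and a: "0 < a"
    and neg: "set_integrable lebesgue {..0} (\<lambda>x. \<bar>m x - mm\<bar>\<^sup>2 * exp (2 * a * \<bar>x\<bar>))"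
    and pos: "set_integrable lebesgue {0..} (\<lambda>x. \<bar>m x - mp\<bar>\<^sup>2 * exp (2 * a * \<bar>x\<bar>))"
  shows "set_integrable lebesgue {..X} (\<lambda>t. (m t / mm - 1)\<^sup>2 * exp (- (2 * a * t)))"
proof -
  let ?Q = "\<lambda>t. (m t / mm - 1)\<^sup>2 * exp (- (2 * a * t))"
  have meas: "set_borel_measurable lebesgue {0..X} ?Q"
    unfolding set_borel_measurable_def using m
    by (intro borel_measurable_scaleR borel_measurable_indicator borel_measurable_times
        borel_measurable_power borel_measurable_diff borel_measurable_divide
        continuous_imp_lebesgue_measurable[of "\<lambda>t. exp (- (2 * a * t))"] continuous_intros) auto
  have q: "(m t / mm - 1)\<^sup>2 = (m t - mm)\<^sup>2 / mm\<^sup>2" for t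
    using mm by (simp add: power_divide[symmetric] diff_divide_distrib)
  have 1: "set_integrable lebesgue {..0} ?Q"
  proof -
    have "set_integrable lebesgue {..0} (\<lambda>x. (\<bar>m x - mm\<bar>\<^sup>2 * exp (2 * a * \<bar>x\<bar>)) / mm\<^sup>2)"
      using neg by (rule set_integrable_divide)
    moreover have "indicator {..0} t *\<^sub>R ((\<bar>m t - mm\<bar>\<^sup>2 * exp (2 * a * \<bar>t\<bar>)) / mm\<^sup>2)
        = indicator {..0} t *\<^sub>R ?Q t" for t :: real
      by (auto simp: q split: split_indicator)
    ultimately show ?thesis unfolding set_integrable_def by simp
  qed
  have 2: "set_integrable lebesgue {0..X} ?Q"
  proof -
    let ?P = "\<lambda>x. \<bar>m x - mp\<bar>\<^sup>2 * exp (2 * a * \<bar>x\<bar>)"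
    have "set_integrable lebesgue {0..X} ?P"
      using pos by (rule set_integrable_subset) auto
    moreover have "set_integrable lebesgue {0..X} (\<lambda>_. (mp - mm)\<^sup>2)"
      unfolding set_integrable_def
      using lmeasurable_interval(1)[of 0 X] by (simp add: lmeasurable_iff_integrable)
    ultimately have "set_integrable lebesgue {0..X} (\<lambda>x. 2 * (?P x + (mp - mm)\<^sup>2) / mm\<^sup>2)"
      by (intro set_integrable_divide set_integrable_mult_right set_integral_add(1))
    then show ?thesis
    proof (rule set_integrable_bound[OF _ meas])
      have "?Q t \<le> 2 * (?P t + (mp - mm)\<^sup>2) / mm\<^sup>2" if "0 \<le> t" for t
      proof -
        have "(m t - mm)\<^sup>2 * exp (- (2 * a * t)) \<le> (m t - mm)\<^sup>2"
          using that a by (intro mult_left_le) auto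
        also have "\<dots> \<le> 2 * ((m t - mp)\<^sup>2 + (mp - mm)\<^sup>2)"
          using sum_squares_bound[of "m t - mp" "mp - mm"]
          by (simp add: power2_eq_square algebra_simps)
        also have "\<dots> \<le> 2 * (?P t + (mp - mm)\<^sup>2)"
          using that a mult_left_mono[of 1 "exp (2 * a * \<bar>t\<bar>)" "(m t - mp)\<^sup>2"] by auto
        finally show ?thesis
          unfolding q by (simp add: divide_right_mono)
      qed
      then show "AE t in lebesgue. t \<in> {0..X} \<longrightarrow> norm (?Q t) \<le> norm (2 * (?P t + (mp - mm)\<^sup>2) / mm\<^sup>2)"
        by (intro AE_I2) (smt (verit) atLeastAtMost_iff real_norm_def exp_gt_zero mult_nonneg_nonneg zero_le_power2)
    qed
  qed
  have "set_integrable lebesgue ({..0} \<union> {0..X}) ?Q"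
    using 1 2 by (rule set_integrable_Un) auto
  then show ?thesis by (rule set_integrable_subset) auto
qed

text \<open>Differentiability is part of the claim, hence the existential quantifiers; uniqueness of
  derivatives makes the witnesses the first and second derivative of \<open>u0\<close>.\<close>

theorem theorem1p5:
  fixes m :: "real \<Rightarrow> real" and mm mp a :: real
  assumes "m \<in> borel_measurable lebesgue"
    and "(m \<longlongrightarrow> mm) at_bot" and "0 < mm"
    and "(m \<longlongrightarrow> mp) at_top" and "0 < mp"
    and "0 < a"
    and "set_integrable lebesgue {..0} (\<lambda>x. \<bar>m x - mm\<bar>\<^sup>2 * exp (2 * a * \<bar>x\<bar>))"
    and "set_integrable lebesgue {0..} (\<lambda>x. \<bar>m x - mp\<bar>\<^sup>2 * exp (2 * a * \<bar>x\<bar>))"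
  shows "\<forall>lam\<in>Omega0_minus. \<exists>u0' u0''.
           (\<forall>x. (u0 m mm lam has_vector_derivative u0' x) (at x)) \<and>
           (\<forall>x. (u0' has_vector_derivative u0'' x) (at x)) \<and>
           L2_on {..0} (u0 m mm lam) \<and> L2_on {..0} u0' \<and> L2_on {..0} u0''"
proof
  fix lam assume lam: "lam \<in> Omega0_minus"
  define w where "w = \<i> * z_minus mm lam"
  have w: "0 < Re w" "\<And>j. Re ((zeta j - 1) * w) \<le> 0"
    using Omega0_minus_exponents[OF lam \<open>0 < mm\<close>] by (auto simp: w_def)
  \<comment> \<open>The factor w in front of the integral is absorbed into the kernel;
    \<open>p\<close> counts derivatives.\<close>
  define k where "k p s = w * kern w p s" for p s
  define C where "C p = norm w * ((\<Sum>j<3. norm (zeta j * ((zeta j - 1) * w) ^ p)) / 3)" for p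
  have k_continuous: "continuous_on UNIV (k p)" for p
    unfolding k_def by (intro continuous_intros kern_continuous)
  have k_bounded: "norm (k p s) \<le> C p" if "0 \<le> s" for p s
    using kern_bounded[OF w(2) that, of p] unfolding k_def C_def norm_mult
    by (intro mult_left_mono) (auto simp: norm_mult)
  have k_deriv: "(k p has_vector_derivative k (Suc p) s) (at s)" for p s
    unfolding k_def by (intro has_vector_derivative_mult_right kern_has_vector_derivative)
  have k_0: "k 0 0 = 0" "k (Suc 0) 0 = 0"
    using kern_at_0 by (simp_all add: k_def)
  define q where "q t = m t / mm - 1" for t
  interpret volterra q a "C 0" "k 0"
  proof
    show "q \<in> borel_measurable lebesgue"
      unfolding q_def using assms(1) by measurable
    show "set_integrable lebesgue {..X} (\<lambda>t. (q t)\<^sup>2 * exp (- (2 * a * t)))" for X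
      unfolding q_def using assms by (intro weighted_L2_atMost) auto
  qed (use \<open>0 < a\<close> k_continuous k_bounded in auto)
  have jost_op: "jost_op m mm lam = V"
  proof (intro ext)
    fix f x
    have "jost_op m mm lam f x = (LINT t:{..x}|lebesgue. w * (
        exp (w * complex_of_real (t - x)) * s2 (w * complex_of_real (x - t)) *
        complex_of_real (m t / mm - 1) * f t))"
      unfolding jost_op_def w_def[symmetric] by (rule set_integral_mult_right[symmetric])
    also have "\<dots> = V f x"
    proof -
      have "w * complex_of_real (t - x) = - (w * complex_of_real (x - t))" for t
        by (simp add: algebra_simps)
      then show ?thesis
        unfolding V_def half_conv_def k_def kern_0_eq q_def by (simp only: mult.assoc)
    qed
    finally show "jost_op m mm lam f x = V f x" .
  qed
  have phi0: "phi0 m mm lam = neumann"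
    unfolding phi0_def[abs_def] neumann_def[abs_def] iter_def jost_op ..
  \<comment> \<open>Once the solution is known, the product with \<open>q\<close> is a fixed
    integrable density. Derivatives of the solution then fall on the kernel alone: they are
    \<open>d 1\<close> and \<open>d 2\<close>.\<close>
  define g where "g t = complex_of_real (q t) * neumann t" for t
  have g: "set_integrable lebesgue {..B} g" for B
    unfolding g_def by (rule neumann_integrable)
  define d where "d p = half_conv (k p) g" for p
  have phi_eq: "neumann x = 1 + d 0 x" for x
    using neumann_eq[of x] unfolding V_def d_def g_def[abs_def] .
  \<comment> \<open>The restriction on \<open>p\<close> is genuine: the kernel of order 2 takes the
    value w^3 at 0.\<close>
  have d_deriv: "(d p has_vector_derivative d (Suc p) x) (at x)" if "p < 2" for p x
  proof -
    have "k p 0 = 0" using that k_0 by (auto simp: less_2_cases_iff)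
    then show ?thesis
      unfolding d_def
      by (rule half_conv_has_vector_derivative[OF k_deriv _ k_bounded k_continuous k_bounded g])
  qed
  have d_cont: "continuous_on UNIV (d p)" for p
    unfolding d_def by (rule half_conv_continuous[OF k_continuous k_bounded g])
  have d_bound: "\<exists>B. \<forall>x\<le>0. norm (d p x) \<le> B" for p
    unfolding d_def using norm_half_conv_le[OF k_continuous k_bounded g, where X = 0]
    by (intro exI allI impI)
  then obtain B where B: "\<And>p x. x \<le> 0 \<Longrightarrow> norm (d p x) \<le> B p" by metis
  let ?e = "\<lambda>x. exp (w * complex_of_real x)"
  \<comment> \<open>The product rule for exp(w x) f(x) replaces f by w f + f'. Two applications turn
    \<open>f0\<close> into \<open>f1\<close> and \<open>f1\<close> into \<open>f2\<close>.\<close>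
  define f0 where "f0 x = 1 + d 0 x" for x
  define f1 where "f1 x = w * f0 x + d 1 x" for x
  define f2 where "f2 x = w * f1 x + (w * d 1 x + d 2 x)" for x
  have u: "u0 m mm lam = (\<lambda>x. ?e x * f0 x)"
    by (simp add: u0_def phi0 phi_eq w_def f0_def fun_eq_iff)
  have e_deriv: "(?e has_vector_derivative ?e x * w) (at x)" for x
    by (rule has_vector_derivative_real_field[where f = "\<lambda>z. exp (w * z)"])
      (auto intro!: derivative_eq_intros)
  have f0_deriv: "(f0 has_vector_derivative d 1 x) (at x)" for x
    unfolding f0_def using d_deriv[of 0 x] by (auto intro!: derivative_eq_intros)
  have f1_deriv: "(f1 has_vector_derivative w * d 1 x + d 2 x) (at x)" for x
    unfolding f1_def using d_deriv[of 1 x]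
    by (intro has_vector_derivative_add has_vector_derivative_mult_right f0_deriv)
      (simp add: numeral_2_eq_2)
  have bounds: "norm (f0 x) \<le> 1 + B 0" "norm (f1 x) \<le> norm w * (1 + B 0) + B 1"
    "norm (f2 x) \<le> norm w * (norm w * (1 + B 0) + B 1) + (norm w * B 1 + B 2)" if "x \<le> 0" for x
  proof -
    show 0: "norm (f0 x) \<le> 1 + B 0"
      unfolding f0_def using B[OF that] by (intro norm_triangle_mono) auto
    show 1: "norm (f1 x) \<le> norm w * (1 + B 0) + B 1"
      unfolding f1_def using B[OF that] 0 by (intro norm_triangle_mono) (auto simp: norm_mult intro!: mult_left_mono)
    show "norm (f2 x) \<le> norm w * (norm w * (1 + B 0) + B 1) + (norm w * B 1 + B 2)"
      unfolding f2_def using B[OF that] 1 by (intro norm_triangle_mono) (auto simp: norm_mult intro!: mult_left_mono)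
  qed
  have conts: "continuous_on UNIV f0" "continuous_on UNIV f1" "continuous_on UNIV f2"
    unfolding f2_def f1_def f0_def by (intro continuous_intros d_cont)+
  show "\<exists>u0' u0''.
           (\<forall>x. (u0 m mm lam has_vector_derivative u0' x) (at x)) \<and>
           (\<forall>x. (u0' has_vector_derivative u0'' x) (at x)) \<and>
           L2_on {..0} (u0 m mm lam) \<and> L2_on {..0} u0' \<and> L2_on {..0} u0''"
  proof (rule exI[of _ "\<lambda>x. ?e x * f1 x"], rule exI[of _ "\<lambda>x. ?e x * f2 x"], intro conjI allI)
    show "(u0 m mm lam has_vector_derivative ?e x * f1 x) (at x)" for x
      unfolding u by (rule has_vector_derivative_eq_rhs[OF has_vector_derivative_mult[OF e_deriv f0_deriv]])
        (simp add: f1_def algebra_simps)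
    show "((\<lambda>x. ?e x * f1 x) has_vector_derivative ?e x * f2 x) (at x)" for x
      by (rule has_vector_derivative_eq_rhs[OF has_vector_derivative_mult[OF e_deriv f1_deriv]])
        (simp add: f2_def algebra_simps)
    show "L2_on {..0} (u0 m mm lam)" "L2_on {..0} (\<lambda>x. ?e x * f1 x)" "L2_on {..0} (\<lambda>x. ?e x * f2 x)"
      unfolding u by (rule L2_on_exp_mult[OF _ bounds(1) w(1)] L2_on_exp_mult[OF _ bounds(2) w(1)]
          L2_on_exp_mult[OF _ bounds(3) w(1)], simp_all add: conts)+
  qed
qed

end
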